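(* Let $\mathcal{O}$ be an Okubo algebra with isotropic norm over a field $\mathbb{F}$ such that $\operatorname{char}\mathbb{F}\neq 3$ and $\mathbb{F}$ does not contain a primitive cube root of unity. For any $x\in Z(\mathcal{O})$ such that $x*x=0$, the set $$V'_x=\{[y]=\mathbb{F}y\mid 0\neq y\in O_{\mathcal{O}}(x)\}$$ forms a connected component in the orthogonality graph $\Gamma_O(\mathcal{O})$. This connected component is a star graph with $[x]$ being its internal node, and its diameter equals $2$.
   Context: For a field $\mathbb{F}$ (arbitrary characteristic) and nonzero $\alpha,\beta\in\mathbb{F}$, let $\mathcal{O}_{\alpha,\beta}$ be the $8$-dimensional $\mathbb{F}$-algebra with basis $z_{1,0},z_{2,0},z_{0,1},z_{0,2},z_{1,1},z_{2,2},z_{1,2},z_{2,1}$ and (bilinear, non-associative) multiplication $*$ given by the table (the entry in row $a$, column $b$ is $a*b$): $$\begin{array}{c|cccccccc} * & z_{1,0} & z_{2,0} & z_{0,1} & z_{0,2} & z_{1,1} & z_{2,2} & z_{1,2} & z_{2,1}\\ \hline z_{1,0} & z_{2,0} & 0 & -z_{1,1} & 0 & -z_{2,1} & 0 & 0 & -\alpha z_{0,1}\\ z_{2,0} & 0 & \alpha z_{1,0} & 0 & -z_{2,2} & 0 & -\alpha z_{1,2} & -\alpha z_{0,2} & 0\\ z_{0,1} & 0 & -z_{2,1} & z_{0,2} & 0 & 0 & -\beta z_{2,0} & 0 & -z_{2,2}\\ z_{0,2} & -z_{1,2} & 0 & 0 & \beta z_{0,1} & -\beta z_{1,0} & 0 &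 -\beta z_{1,1} & 0\\ z_{1,1} & 0 & -\alpha z_{0,1} & -z_{1,2} & 0 & z_{2,2} & 0 & -\beta z_{2,0} & 0\\ z_{2,2} & -\alpha z_{0,2} & 0 & 0 & -\beta z_{2,1} & 0 & \alpha\beta z_{1,1} & 0 & -\alpha\beta z_{1,0}\\ z_{1,2} & -z_{2,2} & 0 & -\beta z_{1,0} & 0 & 0 & -\alpha\beta z_{0,1} & \beta z_{2,1} & 0\\ z_{2,1} & 0 & -\alpha z_{1,1} & 0 & -\beta z_{2,0} & -\alpha z_{0,2} & 0 & 0 & \alpha z_{1,2}\end{array}$$ By the known classification, the Okubo algebras with isotropic norm over $\mathbb{F}$ are exactly the $\mathbb{F}$-algebras isomorphic to $\mathcal{O}_{\alpha,\beta}$ for some nonzero $\alpha,\beta\in\mathbb{F}$; take this as the definition. $Z(\mathcal{O})$ is the set of zero divisors, i.e. nonzero $a$ such that $a*b=0$ or $b*a=0$ for some nonzero $b$; in $\mathcal{O}$ every zero divisor is two-sided. The orthogonalizer of $a$ is $O_{\mathcal{O}}(a)=\{b\in\mathcal{O}\mid a*b=b*a=0\}$. For $x\neq0$ write $[x]=\mathbb{F}x$. The orthogonality graph $\Gamma_O(\mathcal{O})$ is the undirected graph whose vertices are the lines $[a]$ with $a$ a two-sided zero divisor, two distinct vertices $[a],[b]$ being adjacent if and only if $a*b=b*a=0$. *)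

theory Defs
  imports
    "HOL-Analysis.Cartesian_Space"
    "Graph_Theory.Graph_Theory"
begin

datatype okubo_idx = Z10 | Z20 | Z01 | Z02 | Z11 | Z22 | Z12 | Z21

instance okubo_idx :: finite
proof
  have "(UNIV :: okubo_idx set) = {Z10, Z20, Z01, Z02, Z11, Z22, Z12, Z21}"
    using okubo_idx.exhaust by blast
  then show "finite (UNIV :: okubo_idx set)"
    by (metis finite.emptyI finite.insertI)
qed

text \<open>Products of basis elements: \<open>okubo_table a b i j\<close> is the coordinate vector of
  \<open>z\<^sub>i * z\<^sub>j\<close> in \<open>\<O>\<^sub>a\<^sub>,\<^sub>b\<close>.\<close>

fun okubo_table :: "'f::field \<Rightarrow> 'f \<Rightarrow> okubo_idx \<Rightarrow> okubo_idx \<Rightarrow> 'f ^ okubo_idx" where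
  "okubo_table a b Z10 Z10 = axis Z20 1" |
  "okubo_table a b Z10 Z01 = axis Z11 (- 1)" |
  "okubo_table a b Z10 Z11 = axis Z21 (- 1)" |
  "okubo_table a b Z10 Z21 = axis Z01 (- a)" |
  "okubo_table a b Z20 Z20 = axis Z10 a" |
  "okubo_table a b Z20 Z02 = axis Z22 (- 1)" |
  "okubo_table a b Z20 Z22 = axis Z12 (- a)" |
  "okubo_table a b Z20 Z12 = axis Z02 (- a)" |
  "okubo_table a b Z01 Z20 = axis Z21 (- 1)" |
  "okubo_table a b Z01 Z01 = axis Z02 1" |
  "okubo_table a b Z01 Z22 = axis Z20 (- b)" |
  "okubo_table a b Z01 Z21 = axis Z22 (- 1)" |
  "okubo_table a b Z02 Z10 = axis Z12 (- 1)" |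
  "okubo_table a b Z02 Z02 = axis Z01 b" |
  "okubo_table a b Z02 Z11 = axis Z10 (- b)" |
  "okubo_table a b Z02 Z12 = axis Z11 (- b)" |
  "okubo_table a b Z11 Z20 = axis Z01 (- a)" |
  "okubo_table a b Z11 Z01 = axis Z12 (- 1)" |
  "okubo_table a b Z11 Z11 = axis Z22 1" |
  "okubo_table a b Z11 Z12 = axis Z20 (- b)" |
  "okubo_table a b Z22 Z10 = axis Z02 (- a)" |
  "okubo_table a b Z22 Z02 = axis Z21 (- b)" |
  "okubo_table a b Z22 Z22 = axis Z11 (a * b)" |
  "okubo_table a b Z22 Z21 = axis Z10 (- (a * b))" |
  "okubo_table a b Z12 Z10 = axis Z22 (- 1)" |
  "okubo_table a b Z12 Z01 = axis Z10 (- b)" |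
  "okubo_table a b Z12 Z22 = axis Z01 (- (a * b))" |
  "okubo_table a b Z12 Z12 = axis Z21 b" |
  "okubo_table a b Z21 Z20 = axis Z11 (- a)" |
  "okubo_table a b Z21 Z02 = axis Z20 (- b)" |
  "okubo_table a b Z21 Z11 = axis Z02 (- a)" |
  "okubo_table a b Z21 Z21 = axis Z12 a" |
  "okubo_table _ _ _ _ = 0"

definition okubo_mult ::
  "'f::field \<Rightarrow> 'f \<Rightarrow> 'f ^ okubo_idx \<Rightarrow> 'f ^ okubo_idx \<Rightarrow> 'f ^ okubo_idx" where
  "okubo_mult a b x y = (\<Sum>i\<in>UNIV. \<Sum>j\<in>UNIV. (x $ i * y $ j) *s okubo_table a b i j)"

text \<open>The algebra is the whole type \<open>'a\<close>, with scalar multiplication \<open>s\<close> and product \<open>m\<close>;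
  \<open>Vector_Spaces.linear\<close> includes that \<open>s\<close> makes \<open>'a\<close> a vector space over \<open>'f\<close>.\<close>

definition okubo_algebra_isotropic ::
  "('f::field \<Rightarrow> 'a::ab_group_add \<Rightarrow> 'a) \<Rightarrow> ('a \<Rightarrow> 'a \<Rightarrow> 'a) \<Rightarrow> bool" where
  "okubo_algebra_isotropic s m \<longleftrightarrow>
     (\<exists>a b. a \<noteq> 0 \<and> b \<noteq> 0 \<and>
       (\<exists>\<phi> :: 'f ^ okubo_idx \<Rightarrow> 'a. Vector_Spaces.linear (*s) s \<phi> \<and> bij \<phi> \<and>
          (\<forall>x y. \<phi> (okubo_mult a b x y) = m (\<phi> x) (\<phi> y))))"

definition primitive_root_of_unity :: "nat \<Rightarrow> 'f::field \<Rightarrow> bool" where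
  "primitive_root_of_unity n w \<longleftrightarrow> n > 0 \<and> w ^ n = 1 \<and> (\<forall>k. 0 < k \<and> k < n \<longrightarrow> w ^ k \<noteq> 1)"

definition zero_divisors :: "('a::zero \<Rightarrow> 'a \<Rightarrow> 'a) \<Rightarrow> 'a set" where
  "zero_divisors m = {a. a \<noteq> 0 \<and> (\<exists>b. b \<noteq> 0 \<and> (m a b = 0 \<or> m b a = 0))}"

definition two_sided_zero_divisors :: "('a::zero \<Rightarrow> 'a \<Rightarrow> 'a) \<Rightarrow> 'a set" where
  "two_sided_zero_divisors m =
     {a. a \<noteq> 0 \<and> (\<exists>b. b \<noteq> 0 \<and> m a b = 0) \<and> (\<exists>c. c \<noteq> 0 \<and> m c a = 0)}"

definition orthogonalizer :: "('a::zero \<Rightarrow> 'a \<Rightarrow> 'a) \<Rightarrow> 'a \<Rightarrow> 'a set" where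
  "orthogonalizer m a = {b. m a b = 0 \<and> m b a = 0}"

definition line :: "('f \<Rightarrow> 'a \<Rightarrow> 'a) \<Rightarrow> 'a \<Rightarrow> 'a set" where
  "line s x = {s c x | c. True}"

text \<open>An undirected graph is represented by the symmetric digraph having both arcs \<open>(u, v)\<close>
  and \<open>(v, u)\<close> for every edge. Its connected components are then its strongly connected
  components \<open>pre_digraph.sccs\<close>.\<close>

definition orthogonality_graph ::
  "('f \<Rightarrow> 'a::zero \<Rightarrow> 'a) \<Rightarrow> ('a \<Rightarrow> 'a \<Rightarrow> 'a) \<Rightarrow> ('a set, 'a set \<times> 'a set) pre_digraph" where
  "orthogonality_graph s m = with_proj
     \<lparr> pverts = line s ` two_sided_zero_divisors m,
       parcs = {(line s a, line s b) | a b.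
         a \<in> two_sided_zero_divisors m \<and> b \<in> two_sided_zero_divisors m \<and>
         line s a \<noteq> line s b \<and> m a b = 0 \<and> m b a = 0} \<rparr>"

definition orthogonal_lines ::
  "('f \<Rightarrow> 'a::zero \<Rightarrow> 'a) \<Rightarrow> ('a \<Rightarrow> 'a \<Rightarrow> 'a) \<Rightarrow> 'a \<Rightarrow> 'a set set" where
  "orthogonal_lines s m x = {line s y | y. y \<noteq> 0 \<and> y \<in> orthogonalizer m x}"

text \<open>A star, possibly with infinitely many leaves. The node \<open>c\<close> is internal, i.e. not itself a
  leaf, so it has at least two neighbours.\<close>

definition star_graph_with_internal_node :: "('v, 'e) pre_digraph \<Rightarrow> 'v \<Rightarrow> bool" where
  "star_graph_with_internal_node G c \<longleftrightarrow>
     c \<in> verts G \<and>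
     arcs_ends G = {(u, v). u \<in> verts G \<and> v \<in> verts G \<and> u \<noteq> v \<and> (u = c \<or> v = c)} \<and>
     (\<exists>u v. u \<noteq> v \<and> c \<rightarrow>\<^bsub>G\<^esub> u \<and> c \<rightarrow>\<^bsub>G\<^esub> v)"

text \<open>Distances are shortest path lengths, i.e. every arc has weight 1.\<close>

definition diameter :: "('v, 'e) pre_digraph \<Rightarrow> ereal" where
  "diameter G = (SUP u\<in>verts G. SUP v\<in>verts G. wf_digraph.\<mu> G (\<lambda>_. 1) u v)"

end

theory Submission
  imports Defs
begin

text \<open>Let \<open>n\<close> be the polar form of the norm of the Okubo algebra, and let \<open>x * x = 0\<close>, \<open>x \<noteq> 0\<close>.
  The orthogonalizer of \<open>x\<close> is strictly larger than \<open>[x]\<close>, because it contains \<open>x * w\<close> and \<open>w * x\<close>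
  whenever \<open>n x w = 0\<close>. Let \<open>y\<close> be in the orthogonalizer of \<open>x\<close> but not in \<open>[x]\<close>.

  If \<open>y * y = 0\<close>, then the Okubo identity forces \<open>(y * t) * x = l x\<close> with \<open>l\<^sup>2 + l + 1 = 0\<close> for any
  \<open>t\<close> with \<open>n x t = 0\<close> and \<open>n y t = 1\<close>, so \<open>l\<close> is a primitive cube root of unity, which is excluded.
  Hence \<open>y * y \<noteq> 0\<close>. This square is again orthogonal to \<open>x\<close> and has square zero, so it spans \<open>[x]\<close>.
  Now every \<open>z\<close> orthogonal to \<open>y\<close> is orthogonal to \<open>x\<close> too, and right multiplication of the Okubo
  identity for the pair \<open>y, z\<close> by \<open>y\<close> yields \<open>n x t z = n z t x\<close> for all \<open>t\<close>, that is, \<open>z\<close> lies in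
  \<open>[x]\<close>. So \<open>[x]\<close> is the only neighbour of \<open>[y]\<close>.\<close>

section \<open>Composition algebras with associative norm: axioms and linearised identities\<close>

text \<open>The assumption \<open>okubo_identity\<close> does not follow from the composition identities. If \<open>\<omega>\<close> is a
  primitive cube root of unity, then up to a trace term \<open>x \<star> y + \<omega> \<cdot> (y \<star> x)\<close> is proportional to the
  product of \<open>3 \<times> 3\<close> matrices, and the identity is the coefficient of \<open>\<omega>\<close> in the associative law of
  that product.\<close>

locale okubo_composition = vector_space scale
  for scale :: "'f::field \<Rightarrow> 'a::ab_group_add \<Rightarrow> 'a" (infixr \<open>\<cdot>\<close> 75) +
  fixes mult :: "'a \<Rightarrow> 'a \<Rightarrow> 'a" (infixl \<open>\<star>\<close> 70)
    and q :: "'a \<Rightarrow> 'f"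
    and n :: "'a \<Rightarrow> 'a \<Rightarrow> 'f"
  assumes mult_add_left: "(x + y) \<star> z = x \<star> z + y \<star> z"
    and mult_add_right: "x \<star> (y + z) = x \<star> y + x \<star> z"
    and mult_scale_left: "(c \<cdot> x) \<star> y = c \<cdot> (x \<star> y)"
    and mult_scale_right: "x \<star> (c \<cdot> y) = c \<cdot> (x \<star> y)"
    and q_add: "q (x + y) = q x + q y + n x y"
    and n_add_left: "n (x + y) z = n x z + n y z"
    and n_scale_left: "n (c \<cdot> x) y = c * n x y"
    and n_nondegenerate: "(\<And>y. n x y = 0) \<Longrightarrow> x = 0"
    and n_assoc: "n (x \<star> y) z = n x (y \<star> z)"
    and mult_flex_left: "(x \<star> y) \<star> x = q x \<cdot> y"
    and mult_flex_right: "x \<star> (y \<star> x) = q x \<cdot> y"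
    and okubo_identity:
      "(z \<star> y) \<star> x + x \<star> (y \<star> z) =
         (z \<star> x - x \<star> z) \<star> y - y \<star> (z \<star> x - x \<star> z)
         + n x z \<cdot> y + n x y \<cdot> z - n y z \<cdot> x"
    and four_not_spanning: "span {u, v, w, x} \<noteq> UNIV"
begin

lemma mult_zero [simp]: "0 \<star> x = 0" "x \<star> 0 = 0"
  using mult_add_left[of 0 0 x] mult_add_right[of x 0 0] by simp_all

lemma mult_minus: "(- x) \<star> y = - (x \<star> y)" "x \<star> (- y) = - (x \<star> y)"
  using mult_add_left[of x "- x" y] mult_add_right[of x y "- y"]
  by (simp_all add: eq_neg_iff_add_eq_0 add.commute)

lemma mult_diff: "(x - y) \<star> z = x \<star> z - y \<star> z" "x \<star> (y - z) = x \<star> y - x \<star> z"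
  using mult_add_left[of x "- y" z] mult_add_right[of x y "- z"] by (simp_all add: mult_minus)

lemma n_commute: "n x y = n y x"
  using q_add[of x y] q_add[of y x] by (simp add: add.commute)

lemma n_add_right: "n x (y + z) = n x y + n x z"
  by (metis n_add_left n_commute)

lemma n_scale_right: "n x (c \<cdot> y) = c * n x y"
  by (metis n_scale_left n_commute)

lemma n_diff: "n (x - y) z = n x z - n y z" "n z (x - y) = n z x - n z y"
  using n_add_left[of "x - y" y z] n_add_right[of z "x - y" y] by simp_all

lemma n_zero [simp]: "n 0 x = 0" "n x 0 = 0"
  using n_diff(1)[of 0 0 x] n_diff(2)[of x 0 0] by simp_all

text \<open>These are the cross terms of \<open>mult_flex_left\<close> at \<open>x + z\<close>.
  Exchanging the outer factors in this way drives most of the later computations, in any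
  characteristic.\<close>

lemma mult_polar_left: "(x \<star> y) \<star> z + (z \<star> y) \<star> x = n x z \<cdot> y"
  using mult_flex_left[of "x + z" y]
  by (simp add: mult_add_left mult_add_right mult_flex_left q_add algebra_simps)

lemma mult_polar_right: "x \<star> (y \<star> z) + z \<star> (y \<star> x) = n x z \<cdot> y"
  using mult_flex_right[of "x + z" y]
  by (simp add: mult_add_left mult_add_right mult_flex_right q_add algebra_simps)

lemma exists_dual:
  assumes "x \<noteq> 0"
  obtains v where "n x v = 1"
proof -
  obtain u where "n x u \<noteq> 0"
    using assms n_nondegenerate by blast
  then have "n x (inverse (n x u) \<cdot> u) = 1"
    by (simp add: n_scale_right)
  then show ?thesis by (rule that)
qed

text \<open>Subtracting from \<open>y\<close> its part along \<open>x\<close> leaves a nonzero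
  vector, which has a dual \<open>u\<close>. Projecting \<open>u\<close> along \<open>v\<close> onto
  the hyperplane orthogonal to \<open>x\<close> then gives \<open>t\<close>.\<close>

lemma exists_dual_pair:
  assumes "x \<noteq> 0" and "\<And>c. y \<noteq> c \<cdot> x"
  obtains t where "n x t = 0" and "n y t = 1"
proof -
  obtain v where v: "n x v = 1"
    using exists_dual[OF assms(1)] .
  have "y - n y v \<cdot> x \<noteq> 0"
    using assms(2) by simp
  then obtain u where "n (y - n y v \<cdot> x) u = 1"
    by (rule exists_dual)
  then show ?thesis
    using v by (intro that[of "u - n x u \<cdot> v"])
      (simp_all add: n_diff n_scale_left n_scale_right mult.commute)
qed

section \<open>Orthogonalizers of elements of square zero\<close>

lemma q_eq_0:
  assumes "x \<noteq> 0" "x \<star> x = 0"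
  shows "q x = 0"
  using mult_flex_left[of x x] assms by simp

lemma n_orthogonal:
  assumes "x \<noteq> 0" "x \<star> x = 0" "y \<star> x = 0"
  shows "n x y = 0"
  using mult_polar_left[of x x y] assms by simp

text \<open>For an orthogonal pair the commutator in \<open>okubo_identity\<close> vanishes. The
  argument below uses the Okubo identity only in this form.\<close>

lemma orthogonal_okubo_identity:
  assumes "x \<star> y = 0" "y \<star> x = 0" "n x y = 0"
  shows "(y \<star> t) \<star> x + x \<star> (t \<star> y) = n x t \<cdot> y - n y t \<cdot> x"
  using okubo_identity[of y t x] assms by (simp add: n_commute[of t y])

text \<open>Left multiplication by \<open>x\<close> squares to a map of rank at most one. If
  \<open>n x w = 0\<close>, then \<open>x \<star> w\<close> is killed by \<open>x\<close> from the
  left, and from the right by flexibility because \<open>q x = 0\<close>.\<close>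

lemma mult_left_twice:
  assumes "x \<star> x = 0"
  shows "x \<star> (x \<star> w) = n x w \<cdot> x"
  using mult_polar_right[of x x w] assms by simp

lemma mult_right_twice:
  assumes "x \<star> x = 0"
  shows "(w \<star> x) \<star> x = n x w \<cdot> x"
  using mult_polar_left[of w x x] assms by (simp add: n_commute)

text \<open>If all \<open>x \<star> w\<close> and \<open>w \<star> x\<close> with \<open>n x w = 0\<close> were multiples of \<open>x\<close>, the two multiplications
  by \<open>x\<close> would have ranks too small for \<open>w = (x \<star> w) \<star> v + (v \<star> w) \<star> x\<close>, where \<open>n x v = 1\<close>.\<close>

lemma exists_orthogonal:
  assumes "x \<noteq> 0" "x \<star> x = 0"
  obtains y where "x \<star> y = 0" "y \<star> x = 0" "\<And>c. y \<noteq> c \<cdot> x"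
proof -
  have False if contra: "\<And>y. x \<star> y = 0 \<Longrightarrow> y \<star> x = 0 \<Longrightarrow> \<exists>c. y = c \<cdot> x"
  proof -
    obtain v where v: "n x v = 1"
      using exists_dual[OF assms(1)] .
    have hyper: "n x (w - n x w \<cdot> v) = 0" for w
      using v by (simp add: n_diff n_scale_right)
    have left: "\<exists>a. x \<star> w = n x w \<cdot> (x \<star> v) + a \<cdot> x" for w
    proof -
      have "\<exists>a. x \<star> (w - n x w \<cdot> v) = a \<cdot> x"
        by (rule contra)
          (use hyper[of w] assms in \<open>simp_all add: mult_left_twice mult_flex_left q_eq_0\<close>)
      then show ?thesis
        by (auto simp: mult_diff mult_scale_right algebra_simps)
    qed
    have right: "\<exists>a. w \<star> x = n x w \<cdot> (v \<star> x) + a \<cdot> x" for w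
    proof -
      have "\<exists>a. (w - n x w \<cdot> v) \<star> x = a \<cdot> x"
        by (rule contra)
          (use hyper[of w] assms in \<open>simp_all add: mult_right_twice mult_flex_right q_eq_0\<close>)
      then show ?thesis
        by (auto simp: mult_diff mult_scale_left algebra_simps)
    qed
    \<comment> \<open>By \<open>left\<close> and \<open>right\<close>, the two terms of the formula
      for \<open>w\<close> involve only four vectors, none of which depends on
      \<open>w\<close>.\<close>
    have "w \<in> span {(x \<star> v) \<star> v, x \<star> v, v \<star> x, x}" (is "_ \<in> ?S") for w
    proof -
      obtain a where a: "x \<star> w = n x w \<cdot> (x \<star> v) + a \<cdot> x"
        using left by blast
      obtain b where b: "(v \<star> w) \<star> x = n x (v \<star> w) \<cdot> (v \<star> x) + b \<cdot> x"
        using right by blast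
      have "w = (x \<star> w) \<star> v + (v \<star> w) \<star> x"
        using mult_polar_left[of x w v] v by simp
      also have "\<dots> = n x w \<cdot> ((x \<star> v) \<star> v) + a \<cdot> (x \<star> v)
          + (n x (v \<star> w) \<cdot> (v \<star> x) + b \<cdot> x)"
        unfolding a b by (simp add: mult_add_left mult_scale_left)
      also have "\<dots> \<in> ?S"
        by (intro span_add span_scale span_base) simp_all
      finally show ?thesis .
    qed
    then show False
      using four_not_spanning by blast
  qed
  then show ?thesis
    using that by blast
qed

text \<open>The vector \<open>x\<close> turns out to be an eigenvector of left multiplication by
  \<open>w = y \<star> t\<close>, with eigenvalue \<open>l\<close>. Evaluating
  \<open>x \<star> (w \<star> w)\<close> in two ways gives the quadratic equation for
  \<open>l\<close>.\<close>

lemma null_pair_imp_root: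
  assumes "x \<noteq> 0" and indep: "\<And>c. y \<noteq> c \<cdot> x"
    and xx: "x \<star> x = 0" and yy: "y \<star> y = 0" and xy: "x \<star> y = 0" and yx: "y \<star> x = 0"
  obtains l :: 'f where "l * l + l + 1 = 0"
proof -
  obtain t where t: "n x t = 0" "n y t = 1"
    using exists_dual_pair[OF assms(1) indep] .
  define w where "w = y \<star> t"
  define p where "p = w \<star> x"
  have qx: "q x = 0"
    using assms(1) xx by (rule q_eq_0)
  have nxw: "n x w = 0"
    using n_assoc[of x y t] by (simp add: w_def xy)
  have xw: "x \<star> w = 0"
    using mult_polar_right[of x y t] by (simp add: w_def t yx)
  have xp: "x \<star> p = 0"
    by (simp add: p_def mult_flex_right qx)
  have px: "p \<star> x = 0"
    by (simp add: p_def mult_right_twice xx nxw)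
  have nxp: "n x p = 0"
    by (rule n_orthogonal[OF assms(1) xx px])
  \<comment> \<open>Since \<open>p\<close> is orthogonal to \<open>x\<close>,
    \<open>orthogonal_okubo_identity\<close> applies to this pair. Both terms on its left-hand side
    vanish, so its right-hand side does too.\<close>
  have p_multiple: "n x u \<cdot> p = n p u \<cdot> x" for u
  proof -
    have "x \<star> (u \<star> p) = 0"
    proof -
      have "u \<star> p = n u x \<cdot> w - x \<star> (w \<star> u)"
        using mult_polar_right[of u w x] by (simp add: p_def eq_diff_eq)
      moreover have "n x (w \<star> u) = 0"
        using n_assoc[of x w u] by (simp add: xw)
      ultimately show ?thesis
        by (simp add: mult_diff mult_scale_right xw mult_left_twice xx)
    qed
    moreover have "(p \<star> u) \<star> x = 0"
    proof -
      have "p \<star> u = n w u \<cdot> x - (u \<star> x) \<star> w"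
        using mult_polar_left[of w x u] by (simp add: p_def eq_diff_eq)
      moreover have "((u \<star> x) \<star> w) \<star> x = 0"
        using mult_polar_left[of "u \<star> x" w x] by (simp add: xw n_assoc xx)
      ultimately show ?thesis
        by (simp add: mult_diff mult_scale_left xx)
    qed
    ultimately show ?thesis
      using orthogonal_okubo_identity[OF xp px nxp, of u] by simp
  qed
  obtain v where "n x v = 1"
    using exists_dual[OF assms(1)] .
  then obtain l where l: "p = l \<cdot> x"
    using p_multiple[of v] by auto
  have nxy: "n x y = 0"
    by (rule n_orthogonal[OF assms(1) xx yx])
  \<comment> \<open>At \<open>t\<close> the identity for \<open>x\<close>, \<open>y\<close> has
    right-hand side \<open>- x\<close>, and its first term is
    \<open>p = l \<cdot> x\<close>.\<close>
  have xd: "x \<star> (t \<star> y) = - ((l + 1) \<cdot> x)"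
    using orthogonal_okubo_identity[OF xy yx nxy, of t]
    by (simp add: t l flip: p_def w_def)
      (simp add: algebra_simps eq_neg_iff_add_eq_0)
  \<comment> \<open>The aim is to express \<open>w \<star> w\<close> through \<open>y\<close> and
    \<open>t \<star> y\<close>, on which left multiplication by \<open>x\<close> is already
    known.\<close>
  have "w \<star> w = n (t \<star> t) y \<cdot> y - t \<star> y"
  proof -
    have "n y w = 0"
      using n_assoc[of y y t] by (simp add: w_def yy)
    then have "w \<star> w = - ((w \<star> t) \<star> y)"
      using mult_polar_left[of y t w] by (simp add: eq_neg_iff_add_eq_0 flip: w_def)
    moreover have "w \<star> t = t - (t \<star> t) \<star> y"
      using mult_polar_left[of y t t] by (simp add: t w_def eq_diff_eq)
    moreover have "((t \<star> t) \<star> y) \<star> y = n (t \<star> t) y \<cdot> y"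
      by (simp add: mult_right_twice yy n_commute)
    ultimately show ?thesis
      by (simp add: mult_diff)
  qed
  then have "x \<star> (w \<star> w) = (l + 1) \<cdot> x"
    by (simp add: mult_diff mult_scale_right xy xd)
  \<comment> \<open>The first term equals \<open>(l * l) \<cdot> x\<close> and the second
    \<open>(l + 1) \<cdot> x\<close>.\<close>
  moreover have "w \<star> (w \<star> x) + x \<star> (w \<star> w) = 0"
    using mult_polar_right[of w w x] nxw by (simp add: n_commute)
  moreover have "w \<star> x = l \<cdot> x"
    using l by (simp add: p_def)
  ultimately have "(l * l + l + 1) \<cdot> x = 0"
    by (simp add: mult_scale_right algebra_simps)
  with assms(1) have "l * l + l + 1 = 0"
    by simp
  then show ?thesis
    by (rule that)
qed

text \<open>The absence of roots enters twice: for \<open>x\<close>, \<open>y\<close> it makes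
  \<open>w = y \<star> y\<close> nonzero, and for \<open>x\<close>, \<open>w\<close> it places
  \<open>w\<close> on the line of \<open>x\<close>. Relations between \<open>z\<close> and
  \<open>w\<close> thereby become relations between \<open>z\<close> and \<open>x\<close>.\<close>

lemma orthogonal_of_orthogonal:
  assumes no_root: "\<And>l::'f. l * l + l + 1 \<noteq> 0"
    and x: "x \<noteq> 0" "x \<star> x = 0"
    and xy: "x \<star> y = 0" "y \<star> x = 0" and indep: "\<And>c. y \<noteq> c \<cdot> x"
    and yz: "y \<star> z = 0" "z \<star> y = 0"
  obtains c where "z = c \<cdot> x"
proof -
  define w where "w = y \<star> y"
  have nxy: "n x y = 0"
    by (rule n_orthogonal[OF x xy(2)])
  have qy: "q y = 0"
    using mult_flex_left[of y x] xy x(1) by simp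
  have "w \<noteq> 0"
    unfolding w_def using null_pair_imp_root[OF x(1) indep x(2) _ xy] no_root by blast
  have wx: "w \<star> x = 0"
    using mult_polar_left[of y y x] by (simp add: w_def xy nxy n_commute)
  have xw: "x \<star> w = 0"
    using mult_polar_right[of y y x] by (simp add: w_def xy nxy n_commute)
  have nyw: "n y w = 0"
    using mult_polar_left[of y x w] xy wx x(1) by simp
  have "w \<star> w = 0"
    using mult_polar_left[of y y w] by (simp add: nyw qy mult_flex_left flip: w_def)
      (simp add: w_def mult_flex_left qy)
  then have "\<exists>k. w = k \<cdot> x"
    using null_pair_imp_root[of x w] x xw wx no_root by blast
  then obtain k where k: "w = k \<cdot> x" "k \<noteq> 0"
    using \<open>w \<noteq> 0\<close> by auto
  have wz: "w \<star> z = n y z \<cdot> y"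
    using mult_polar_left[of y y z] by (simp add: w_def yz)
  have zw: "z \<star> w = n y z \<cdot> y"
    using mult_polar_right[of z y y] by (simp add: w_def yz n_commute)
  \<comment> \<open>Linearised flexibility with outer factors \<open>w\<close>, \<open>y\<close> has
    zero right-hand side because \<open>n y w = 0\<close>. Its left-hand side is
    \<open>w \<star> z\<close>, a multiple of \<open>y\<close>, times \<open>y\<close>.\<close>
  have nyz: "n y z = 0"
  proof -
    have "n y z \<cdot> w = 0"
      using mult_polar_left[of w z y] nyw
      by (simp add: wz yz mult_scale_left n_commute[of w y] flip: w_def)
    then show ?thesis
      using \<open>w \<noteq> 0\<close> by simp
  qed
  have xz: "z \<star> x = 0"
    using zw k by (simp add: nyz mult_scale_right)
  have multiple: "n x t \<cdot> z = n z t \<cdot> x" for t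
  proof -
    \<comment> \<open>Exchanging the outer factors produces the square
      \<open>w = k \<cdot> x\<close>, which brings \<open>x\<close> into play.\<close>
    have "((z \<star> t) \<star> y) \<star> y = - (k \<cdot> n x t \<cdot> z)"
    proof -
      have "n (z \<star> t) y = 0"
        by (metis n_assoc n_commute yz(1) n_zero(1))
      then have "((z \<star> t) \<star> y) \<star> y = - (w \<star> (z \<star> t))"
        using mult_polar_left[of "z \<star> t" y y] by (simp add: w_def eq_neg_iff_add_eq_0)
      moreover have "x \<star> (z \<star> t) = n x t \<cdot> z"
        using mult_polar_right[of x z t] by (simp add: xz)
      ultimately show ?thesis
        by (simp add: k mult_scale_left)
    qed
    \<comment> \<open>This is the Okubo identity for \<open>y\<close>, \<open>z\<close>, multiplied
      by \<open>y\<close> on the right. The second summand on the left will contribute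
      \<open>q y \<cdot> (t \<star> z) = 0\<close>.\<close>
    moreover have "((z \<star> t) \<star> y + y \<star> (t \<star> z)) \<star> y = - (k \<cdot> n z t \<cdot> x)"
      unfolding orthogonal_okubo_identity[OF yz nyz]
      by (simp add: mult_diff mult_scale_left yz flip: w_def) (simp add: k mult.commute)
    ultimately show ?thesis
      using k(2) by (simp add: mult_add_left mult_flex_left qy del: scale_scale)
  qed
  obtain v where "n x v = 1"
    using exists_dual[OF x(1)] .
  then show ?thesis
    using multiple[of v] that by simp
qed

end

section \<open>Distances and components of star graphs\<close>

lemma (in wf_digraph) awalk_cost_unit: "awalk_cost (\<lambda>_. 1) p = length p"
  by (induction p) simp_all

text \<open>Passing through the centre bounds every distance by 2. Two distinct neighbours of the
  centre are not adjacent, so they attain the bound.\<close>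

lemma diameter_star_graph:
  assumes "wf_digraph H" and star: "star_graph_with_internal_node H c"
  shows "diameter H = 2"
proof -
  interpret wf_digraph H by fact
  have ends: "u \<rightarrow>\<^bsub>H\<^esub> v \<longleftrightarrow> u \<in> verts H \<and> v \<in> verts H \<and> u \<noteq> v \<and> (u = c \<or> v = c)" for u v
    using star by (auto simp: star_graph_with_internal_node_def)
  have c: "c \<in> verts H"
    using star by (simp add: star_graph_with_internal_node_def)
  have arcE: "\<exists>e. awalk u [e] v" if "u \<rightarrow>\<^bsub>H\<^esub> v" for u v
    using that by (auto simp: arcs_ends_conv intro!: arc_implies_awalk)
  have short_walk: "\<exists>p. awalk u p v \<and> length p \<le> 2" if uv: "u \<in> verts H" "v \<in> verts H" for u v
  proof -
    consider "u = v" | "u \<rightarrow>\<^bsub>H\<^esub> v" | "u \<rightarrow>\<^bsub>H\<^esub> c" "c \<rightarrow>\<^bsub>H\<^esub> v"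
      using uv c by (auto simp: ends)
    then show ?thesis
    proof cases
      case 1
      then show ?thesis
        using uv by (intro exI[of _ "[]"]) (simp add: awalk_Nil_iff)
    next
      case 2
      then obtain e where "awalk u [e] v"
        using arcE by blast
      then show ?thesis
        by (intro exI[of _ "[e]"]) simp
    next
      case 3
      then obtain e f where "awalk u [e] c" "awalk c [f] v"
        using arcE by blast
      then have "awalk u ([e] @ [f]) v"
        by (rule awalk_appendI)
      then show ?thesis
        by (intro exI[of _ "[e, f]"]) simp
    qed
  qed
  have upper: "\<mu> (\<lambda>_. 1) u v \<le> 2" if "u \<in> verts H" "v \<in> verts H" for u v
  proof -
    obtain p where p: "awalk u p v" "length p \<le> 2"
      using short_walk \<open>u \<in> verts H\<close> \<open>v \<in> verts H\<close> by blast
    have "\<mu> (\<lambda>_. 1) u v \<le> ereal (real (length p))"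
      using min_cost_le_walk_cost[OF p(1), of "\<lambda>_. 1"] by (simp only: awalk_cost_unit)
    also have "\<dots> \<le> ereal 2"
      using p(2) by simp
    finally show ?thesis
      by simp
  qed
  obtain u v where uv: "u \<noteq> v" "c \<rightarrow>\<^bsub>H\<^esub> u" "c \<rightarrow>\<^bsub>H\<^esub> v"
    using star by (auto simp: star_graph_with_internal_node_def)
  have "2 \<le> \<mu> (\<lambda>_. 1) u v"
    unfolding \<mu>_def
  proof (rule INF_greatest)
    fix p
    assume "p \<in> {p. awalk u p v}"
    then have p: "awalk u p v"
      by simp
    have "\<not> u \<rightarrow>\<^bsub>H\<^esub> v"
      using uv by (auto simp: ends)
    \<comment> \<open>The rule \<open>remdups_adj.cases\<close> splits lists into empty, singleton
      and longer ones. An empty walk would force \<open>u = v\<close>, a singleton an arc from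
      \<open>u\<close> to \<open>v\<close>.\<close>
    then have "2 \<le> length p"
      using p uv(1)
      by (cases p rule: remdups_adj.cases) (auto simp: awalk_simps arcs_ends_conv)
    then show "2 \<le> ereal (awalk_cost (\<lambda>_. 1) p)"
      by (simp add: awalk_cost_unit)
  qed
  also have "\<dots> \<le> diameter H"
  proof -
    have "u \<in> verts H" "v \<in> verts H"
      using uv by (auto simp: ends)
    then show ?thesis
      unfolding diameter_def by (intro SUP_upper2[of u] SUP_upper)
  qed
  finally have "2 \<le> diameter H" .
  moreover have "diameter H \<le> 2"
    unfolding diameter_def using upper by (auto intro!: SUP_least)
  ultimately show ?thesis
    by (rule antisym[rotated])
qed

text \<open>No arc leaves \<open>S\<close>, so \<open>S\<close> is the set of vertices reachable
  from \<open>c\<close>. In a symmetric digraph such a set induces a strongly connected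
  component.\<close>

lemma (in sym_digraph) star_component:
  assumes c: "c \<in> verts G"
    and center: "\<And>u. c \<rightarrow>\<^bsub>G\<^esub> u \<longleftrightarrow> u \<in> S \<and> u \<noteq> c" and "c \<in> S"
    and leaf: "\<And>u v. u \<in> S \<Longrightarrow> u \<noteq> c \<Longrightarrow> u \<rightarrow>\<^bsub>G\<^esub> v \<Longrightarrow> v = c"
    and two: "\<exists>u v. u \<noteq> v \<and> c \<rightarrow>\<^bsub>G\<^esub> u \<and> c \<rightarrow>\<^bsub>G\<^esub> v"
  shows "G \<restriction> S \<in> sccs \<and> star_graph_with_internal_node (G \<restriction> S) c \<and> diameter (G \<restriction> S) = 2"
proof -
  have S: "S = {v. c \<rightarrow>\<^sup>* v}"
  proof (intro equalityI subsetI CollectI)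
    fix v assume "v \<in> S"
    then show "c \<rightarrow>\<^sup>* v"
      using c center[of v] by (cases "v = c") auto
  next
    fix v assume "v \<in> {v. c \<rightarrow>\<^sup>* v}"
    then have "c \<rightarrow>\<^sup>* v"
      by simp
    then show "v \<in> S"
    proof (induction rule: reachable_induct)
      case base
      show ?case by fact
    next
      case (step u v)
      then show ?case
        using center leaf \<open>c \<in> S\<close> by metis
    qed
  qed
  have scc: "G \<restriction> S \<in> sccs"
    unfolding S using c by (rule induce_reachable_is_in_sccs)
  have leaf': "u = c \<or> v = c" if "u \<in> S" "v \<in> S" "u \<rightarrow>\<^bsub>G\<^esub> v" for u v
    using leaf that by blast
  have sym_G: "u \<rightarrow>\<^bsub>G\<^esub> v \<longleftrightarrow> v \<rightarrow>\<^bsub>G\<^esub> u" for u v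
    using arcs_ends_symmetric[OF sym_arcs] by blast
  have ends: "u \<rightarrow>\<^bsub>G \<restriction> S\<^esub> v \<longleftrightarrow> u \<in> S \<and> v \<in> S \<and> u \<rightarrow>\<^bsub>G\<^esub> v" for u v
    by (auto simp: arcs_ends_conv)
  have "arcs_ends (G \<restriction> S) = {(u, v). u \<in> S \<and> v \<in> S \<and> u \<noteq> v \<and> (u = c \<or> v = c)}"
    using center leaf' sym_G by (auto simp: ends) metis+
  moreover have "\<exists>u v. u \<noteq> v \<and> c \<rightarrow>\<^bsub>G \<restriction> S\<^esub> u \<and> c \<rightarrow>\<^bsub>G \<restriction> S\<^esub> v"
    using two center \<open>c \<in> S\<close> by (auto simp: ends)
  ultimately have star: "star_graph_with_internal_node (G \<restriction> S) c"
    using \<open>c \<in> S\<close> by (simp add: star_graph_with_internal_node_def)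
  have "wf_digraph (G \<restriction> S)"
    using scc by (auto intro: wf_digraphI_induced dest: in_sccs_imp_induced)
  then show ?thesis
    using scc star by (simp add: diameter_star_graph)
qed

section \<open>The orthogonality graph around an element of square zero\<close>

lemma arcs_ends_orthogonality_graph:
  "arcs_ends (orthogonality_graph s m) = {(line s a, line s b) | a b.
     a \<in> two_sided_zero_divisors m \<and> b \<in> two_sided_zero_divisors m \<and>
     line s a \<noteq> line s b \<and> m a b = 0 \<and> m b a = 0}"
  by (simp add: orthogonality_graph_def arcs_ends_conv)

lemma sym_digraph_orthogonality_graph: "sym_digraph (orthogonality_graph s m)"
proof
  show "symmetric (orthogonality_graph s m)"
    unfolding symmetric_def arcs_ends_orthogonality_graph
  proof (rule symI, elim CollectE exE conjE Pair_inject)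
    fix u v a b
    assume "u = line s a" "v = line s b" "a \<in> two_sided_zero_divisors m"
      "b \<in> two_sided_zero_divisors m" "line s a \<noteq> line s b" "m a b = 0" "m b a = 0"
    then show "(v, u) \<in> {(line s a, line s b) | a b.
        a \<in> two_sided_zero_divisors m \<and> b \<in> two_sided_zero_divisors m \<and>
        line s a \<noteq> line s b \<and> m a b = 0 \<and> m b a = 0}"
      by (intro CollectI exI[of _ b] exI[of _ a]) simp
  qed
qed (auto simp: orthogonality_graph_def)

context okubo_composition
begin

lemma line_eq_imp_multiple:
  assumes "line scale a = line scale b"
  shows "\<exists>k. a = k \<cdot> b"
proof -
  have "1 \<cdot> a \<in> line scale a"
    unfolding line_def by blast
  then show ?thesis
    unfolding assms by (auto simp: line_def)
qed

lemma line_multiple: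
  assumes "k \<cdot> b \<noteq> 0"
  shows "line scale (k \<cdot> b) = line scale b"
proof -
  have "c \<cdot> b = (c / k) \<cdot> (k \<cdot> b)" for c
    using assms by simp
  then show ?thesis
    unfolding line_def by (metis scale_scale)
qed

lemma star_component_orthogonality_graph:
  assumes no_root: "\<And>l::'f. l * l + l + 1 \<noteq> 0" and x: "x \<noteq> 0" "x \<star> x = 0"
  defines "G \<equiv> orthogonality_graph scale mult" and "S \<equiv> orthogonal_lines scale mult x"
  shows "G \<restriction> S \<in> pre_digraph.sccs G \<and> star_graph_with_internal_node (G \<restriction> S) (line scale x)
    \<and> diameter (G \<restriction> S) = 2"
proof -
  interpret sym_digraph G
    unfolding G_def by (rule sym_digraph_orthogonality_graph)
  let ?L = "line scale"
  note arcs_ends_G = arcs_ends_orthogonality_graph[of scale mult, folded G_def]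
  have arcE: "\<exists>b. v = ?L b \<and> b \<noteq> 0 \<and> y \<star> b = 0 \<and> b \<star> y = 0 \<and> v \<noteq> ?L y"
    if arc: "?L y \<rightarrow>\<^bsub>G\<^esub> v" for y v
  proof -
    obtain a b where ab: "?L y = ?L a" "v = ?L b" "b \<in> two_sided_zero_divisors mult"
        "?L a \<noteq> ?L b" "a \<star> b = 0" "b \<star> a = 0"
      using arc unfolding arcs_ends_G by (elim CollectE exE conjE Pair_inject) (rule that)
    \<comment> \<open>The arc supplies its own representative \<open>a\<close> of the line of
      \<open>y\<close>. Bilinearity carries the orthogonality over to \<open>y\<close>.\<close>
    obtain k where "y = k \<cdot> a"
      using line_eq_imp_multiple[OF ab(1)] ..
    then show ?thesis
      using ab by (auto simp: mult_scale_left mult_scale_right two_sided_zero_divisors_def)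
  qed
  have zd: "y \<in> two_sided_zero_divisors mult" if "y \<noteq> 0" "x \<star> y = 0" "y \<star> x = 0" for y
    using that x by (auto simp: two_sided_zero_divisors_def)
  have center: "?L x \<rightarrow>\<^bsub>G\<^esub> u \<longleftrightarrow> u \<in> S \<and> u \<noteq> ?L x" for u
  proof
    assume "?L x \<rightarrow>\<^bsub>G\<^esub> u"
    then show "u \<in> S \<and> u \<noteq> ?L x"
      by (auto simp: S_def orthogonal_lines_def orthogonalizer_def dest!: arcE)
  next
    assume "u \<in> S \<and> u \<noteq> ?L x"
    then obtain y where "u = ?L y" "?L x \<noteq> ?L y" "y \<noteq> 0" "x \<star> y = 0" "y \<star> x = 0"
      by (auto simp: S_def orthogonal_lines_def orthogonalizer_def)
    then show "?L x \<rightarrow>\<^bsub>G\<^esub> u"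
      unfolding arcs_ends_G using zd[of x] zd[of y] x by blast
  qed
  show ?thesis
  proof (rule star_component)
    show "?L x \<in> verts G"
      using zd[of x] x by (simp add: G_def orthogonality_graph_def)
    show "?L x \<in> S"
      using x by (auto simp: S_def orthogonal_lines_def orthogonalizer_def)
    show "?L x \<rightarrow>\<^bsub>G\<^esub> u \<longleftrightarrow> u \<in> S \<and> u \<noteq> ?L x" for u
      by (rule center)
  next
    fix u v
    assume "u \<in> S" "u \<noteq> ?L x" "u \<rightarrow>\<^bsub>G\<^esub> v"
    then obtain y where y: "u = ?L y" "y \<noteq> 0" "x \<star> y = 0" "y \<star> x = 0"
      by (auto simp: S_def orthogonal_lines_def orthogonalizer_def)
    have "y \<noteq> c \<cdot> x" for c
      using y \<open>u \<noteq> ?L x\<close> line_multiple by metis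
    moreover obtain z where z: "v = ?L z" "z \<noteq> 0" "y \<star> z = 0" "z \<star> y = 0"
      using arcE[of y v] \<open>u \<rightarrow>\<^bsub>G\<^esub> v\<close> y by blast
    ultimately obtain c where "z = c \<cdot> x"
      using orthogonal_of_orthogonal[OF no_root x y(3,4)] by blast
    then show "v = ?L x"
      using z line_multiple by metis
  next
    obtain y where y: "x \<star> y = 0" "y \<star> x = 0" "\<And>c. y \<noteq> c \<cdot> x"
      using exists_orthogonal[OF x] by blast
    \<comment> \<open>A second leaf is \<open>x + y\<close>: it is orthogonal to \<open>x\<close>
      because \<open>x \<star> x = 0\<close>, and its line differs from those of \<open>x\<close>
      and \<open>y\<close> over every field.\<close>
    have "x + y \<noteq> c \<cdot> x" for c
      using y(3)[of "c - 1"] by (auto simp: scale_left_diff_distrib algebra_simps)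
    moreover have "x + y \<noteq> c \<cdot> y" for c
    proof
      assume "x + y = c \<cdot> y"
      then have eq: "x = (c - 1) \<cdot> y"
        by (simp add: scale_left_diff_distrib algebra_simps)
      with x have "y = inverse (c - 1) \<cdot> x"
        by auto
      then show False
        using y(3) by blast
    qed
    ultimately have "?L (x + y) \<noteq> ?L x" "?L (x + y) \<noteq> ?L y" "?L y \<noteq> ?L x" "x + y \<noteq> 0" "y \<noteq> 0"
      using y(3) line_eq_imp_multiple by (metis scale_zero_left)+
    moreover have "?L y \<in> S" "?L (x + y) \<in> S" if "x + y \<noteq> 0" "y \<noteq> 0"
      using y x that
      by (auto simp: S_def orthogonal_lines_def orthogonalizer_def mult_add_left mult_add_right)
    ultimately show "\<exists>u v. u \<noteq> v \<and> ?L x \<rightarrow>\<^bsub>G\<^esub> u \<and> ?L x \<rightarrow>\<^bsub>G\<^esub> v"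
      unfolding center by blast
  qed
qed

end

section \<open>Transport along an algebra isomorphism\<close>

lemma okubo_composition_transfer:
  assumes "okubo_composition s m q n"
    and "Vector_Spaces.linear s s' \<phi>"
    and "bij \<phi>"
    and hom: "\<And>x y. \<phi> (m x y) = m' (\<phi> x) (\<phi> y)"
  shows "okubo_composition s' m' (q \<circ> inv \<phi>) (\<lambda>x y. n (inv \<phi> x) (inv \<phi> y))"
proof -
  interpret A: okubo_composition s m q n by fact
  interpret L: Vector_Spaces.linear s s' \<phi> by fact
  have inv_\<phi> [simp]: "inv \<phi> (\<phi> x) = x" for x
    using \<open>bij \<phi>\<close> by (simp add: bij_is_inj)
  have surj: "\<exists>y. x = \<phi> y" for x
    using \<open>bij \<phi>\<close> by (metis bij_pointE)
  have \<phi>_eq_0: "\<phi> x = 0 \<longleftrightarrow> x = 0" for x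
    using inv_\<phi> L.zero by metis
  \<comment> \<open>The homomorphism rules are reversed to collect \<open>\<phi>\<close> on the
    outside, where \<open>inv \<phi>\<close> cancels it.\<close>
  note \<phi>_simps = hom[symmetric] L.add[symmetric] L.scale[symmetric] L.diff[symmetric]
  show ?thesis
  proof
    fix x y z c
    obtain x' y' z' where [simp]: "x = \<phi> x'" "y = \<phi> y'" "z = \<phi> z'"
      using surj by meson
    show "m' (x + y) z = m' x z + m' y z"
      by (simp add: \<phi>_simps A.mult_add_left)
    show "m' x (y + z) = m' x y + m' x z"
      by (simp add: \<phi>_simps A.mult_add_right)
    show "m' (s' c x) y = s' c (m' x y)"
      by (simp add: \<phi>_simps A.mult_scale_left)
    show "m' x (s' c y) = s' c (m' x y)"
      by (simp add: \<phi>_simps A.mult_scale_right)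
    show "(q \<circ> inv \<phi>) (x + y) = (q \<circ> inv \<phi>) x + (q \<circ> inv \<phi>) y + n (inv \<phi> x) (inv \<phi> y)"
      by (simp add: \<phi>_simps A.q_add)
    show "n (inv \<phi> (x + y)) (inv \<phi> z) = n (inv \<phi> x) (inv \<phi> z) + n (inv \<phi> y) (inv \<phi> z)"
      by (simp add: \<phi>_simps A.n_add_left)
    show "n (inv \<phi> (s' c x)) (inv \<phi> y) = c * n (inv \<phi> x) (inv \<phi> y)"
      by (simp add: \<phi>_simps A.n_scale_left)
    show "n (inv \<phi> (m' x y)) (inv \<phi> z) = n (inv \<phi> x) (inv \<phi> (m' y z))"
      by (simp add: \<phi>_simps A.n_assoc)
    show "m' (m' x y) x = s' ((q \<circ> inv \<phi>) x) y"
      by (simp add: \<phi>_simps A.mult_flex_left)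
    show "m' x (m' y x) = s' ((q \<circ> inv \<phi>) x) y"
      by (simp add: \<phi>_simps A.mult_flex_right)
    show "m' (m' z y) x + m' x (m' y z) =
        m' (m' z x - m' x z) y - m' y (m' z x - m' x z)
        + s' (n (inv \<phi> x) (inv \<phi> z)) y + s' (n (inv \<phi> x) (inv \<phi> y)) z
        - s' (n (inv \<phi> y) (inv \<phi> z)) x"
      by (simp add: \<phi>_simps A.okubo_identity)
  next
    fix x
    assume nondeg: "\<And>y. n (inv \<phi> x) (inv \<phi> y) = 0"
    obtain x' where "x = \<phi> x'"
      using surj by meson
    then show "x = 0"
      using A.n_nondegenerate[of x'] nondeg[of "\<phi> _"] by (simp add: \<phi>_eq_0)
  next
    fix u v w x
    obtain u' v' w' x' where [simp]: "u = \<phi> u'" "v = \<phi> v'" "w = \<phi> w'" "x = \<phi> x'"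
      using surj by meson
    have "L.vs2.span {u, v, w, x} = \<phi> ` A.span {u', v', w', x'}"
      by (simp flip: L.span_image)
    also have "\<dots> \<noteq> UNIV"
    proof
      assume eq: "\<phi> ` A.span {u', v', w', x'} = UNIV"
      have "y \<in> A.span {u', v', w', x'}" for y
        using eq inv_\<phi> by (metis UNIV_I imageE)
      then show False
        using A.four_not_spanning by blast
    qed
    finally show "L.vs2.span {u, v, w, x} \<noteq> UNIV" .
  qed
qed

section \<open>The norm and the defining identities in coordinates\<close>

lemma UNIV_okubo_idx: "UNIV = {Z10, Z20, Z01, Z02, Z11, Z22, Z12, Z21}"
  using okubo_idx.exhaust by blast

lemma all_okubo_idx:
  "(\<forall>i. P i) \<longleftrightarrow> P Z10 \<and> P Z20 \<and> P Z01 \<and> P Z02 \<and> P Z11 \<and> P Z22 \<and> P Z12 \<and> P Z21"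
  by (metis okubo_idx.exhaust)

lemma okubo_mult_nth:
  "okubo_mult a b x y $ Z10 =
    a * x $ Z20 * y $ Z20 - b * x $ Z02 * y $ Z11 - a * b * x $ Z22 * y $ Z21 - b * x $ Z12 * y $ Z01"
  "okubo_mult a b x y $ Z20 =
    x $ Z10 * y $ Z10 - b * x $ Z01 * y $ Z22 - b * x $ Z11 * y $ Z12 - b * x $ Z21 * y $ Z02"
  "okubo_mult a b x y $ Z01 =
    - a * x $ Z10 * y $ Z21 + b * x $ Z02 * y $ Z02 - a * x $ Z11 * y $ Z20 - a * b * x $ Z12 * y $ Z22"
  "okubo_mult a b x y $ Z02 =
    - a * x $ Z20 * y $ Z12 + x $ Z01 * y $ Z01 - a * x $ Z22 * y $ Z10 - a * x $ Z21 * y $ Z11"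
  "okubo_mult a b x y $ Z11 =
    - x $ Z10 * y $ Z01 - b * x $ Z02 * y $ Z12 + a * b * x $ Z22 * y $ Z22 - a * x $ Z21 * y $ Z20"
  "okubo_mult a b x y $ Z22 =
    - x $ Z20 * y $ Z02 - x $ Z01 * y $ Z21 + x $ Z11 * y $ Z11 - x $ Z12 * y $ Z10"
  "okubo_mult a b x y $ Z12 =
    - a * x $ Z20 * y $ Z22 - x $ Z02 * y $ Z10 - x $ Z11 * y $ Z01 + a * x $ Z21 * y $ Z21"
  "okubo_mult a b x y $ Z21 =
    - x $ Z10 * y $ Z11 - x $ Z01 * y $ Z20 - b * x $ Z22 * y $ Z02 + b * x $ Z12 * y $ Z12"
  by (simp_all add: okubo_mult_def UNIV_okubo_idx axis_def mult_ac)

text \<open>Each basis vector pairs only with the one of opposite index modulo 3, giving four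
  weighted hyperbolic planes. The weights come from \<open>mult_polar_left\<close>: for instance
  \<open>Z10\<close>, \<open>Z01\<close>, \<open>Z20\<close> in place of \<open>x\<close>,
  \<open>y\<close>, \<open>z\<close> give \<open>a\<close>.\<close>

definition okubo_polar :: "'f::field \<Rightarrow> 'f \<Rightarrow> 'f ^ okubo_idx \<Rightarrow> 'f ^ okubo_idx \<Rightarrow> 'f" where
  "okubo_polar a b x y =
     a * (x $ Z10 * y $ Z20 + x $ Z20 * y $ Z10) + b * (x $ Z01 * y $ Z02 + x $ Z02 * y $ Z01)
     + a * b * (x $ Z11 * y $ Z22 + x $ Z22 * y $ Z11 + x $ Z12 * y $ Z21 + x $ Z21 * y $ Z12)"

definition okubo_norm :: "'f::field \<Rightarrow> 'f \<Rightarrow> 'f ^ okubo_idx \<Rightarrow> 'f" where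
  "okubo_norm a b x =
     a * x $ Z10 * x $ Z20 + b * x $ Z01 * x $ Z02 + a * b * (x $ Z11 * x $ Z22 + x $ Z12 * x $ Z21)"

text \<open>The algebraic laws are polynomial identities in \<open>a\<close>, \<open>b\<close> and
  the coordinates. Nondegeneracy rests on the weights \<open>a\<close>, \<open>b\<close>,
  \<open>a * b\<close> being nonzero, and the spanning condition on 8 > 4.\<close>

lemma okubo_composition_okubo_mult:
  fixes a b :: "'f::field"
  assumes "a \<noteq> 0" "b \<noteq> 0"
  shows "okubo_composition (*s) (okubo_mult a b) (okubo_norm a b) (okubo_polar a b)"
proof
  note coordinates = vec_eq_iff all_okubo_idx okubo_norm_def okubo_polar_def okubo_mult_nth
    vector_add_component vector_minus_component vector_smult_component
  fix x y z :: "'f ^ okubo_idx" and c :: 'f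
  show "okubo_mult a b (x + y) z = okubo_mult a b x z + okubo_mult a b y z"
    by (simp add: coordinates algebra_simps)
  show "okubo_mult a b x (y + z) = okubo_mult a b x y + okubo_mult a b x z"
    by (simp add: coordinates algebra_simps)
  show "okubo_mult a b (c *s x) y = c *s okubo_mult a b x y"
    by (simp add: coordinates algebra_simps)
  show "okubo_mult a b x (c *s y) = c *s okubo_mult a b x y"
    by (simp add: coordinates algebra_simps)
  show "okubo_norm a b (x + y) = okubo_norm a b x + okubo_norm a b y + okubo_polar a b x y"
    by (simp add: okubo_norm_def okubo_polar_def algebra_simps)
  show "okubo_polar a b (x + y) z = okubo_polar a b x z + okubo_polar a b y z"
    by (simp add: okubo_polar_def algebra_simps)
  show "okubo_polar a b (c *s x) y = c * okubo_polar a b x y"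
    by (simp add: okubo_polar_def algebra_simps)
  show "okubo_polar a b (okubo_mult a b x y) z = okubo_polar a b x (okubo_mult a b y z)"
    by (simp only: okubo_polar_def okubo_mult_nth; algebra)
  show "okubo_mult a b (okubo_mult a b x y) x = okubo_norm a b x *s y"
    by (simp only: coordinates; intro conjI; algebra)
  show "okubo_mult a b x (okubo_mult a b y x) = okubo_norm a b x *s y"
    by (simp only: coordinates; intro conjI; algebra)
  show "okubo_mult a b (okubo_mult a b z y) x + okubo_mult a b x (okubo_mult a b y z) =
      okubo_mult a b (okubo_mult a b z x - okubo_mult a b x z) y
      - okubo_mult a b y (okubo_mult a b z x - okubo_mult a b x z)
      + okubo_polar a b x z *s y + okubo_polar a b x y *s z - okubo_polar a b y z *s x"
    by (simp only: coordinates; intro conjI; algebra)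
next
  fix x :: "'f ^ okubo_idx"
  assume "\<And>y. okubo_polar a b x y = 0"
  \<comment> \<open>Pairing with a basis vector isolates, up to a nonzero weight, the coordinate of
    opposite index.\<close>
  then have "\<forall>i. okubo_polar a b x (axis i 1) = 0"
    by blast
  then show "x = 0"
    using assms by (simp add: all_okubo_idx okubo_polar_def axis_def vec_eq_iff)
next
  fix u v w x :: "'f ^ okubo_idx"
  show "vec.span {u, v, w, x} \<noteq> UNIV"
  proof
    assume "vec.span {u, v, w, x} = UNIV"
    then have "vec.dim (UNIV :: ('f ^ okubo_idx) set) \<le> card {u, v, w, x}"
      by (intro vec.dim_le_card) simp_all
    also have "\<dots> \<le> 4"
      by (simp add: card_insert_if)
    finally have "CARD(okubo_idx) \<le> 4"
      by (simp only: vec_dim_card)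
    then show False
      by (simp add: UNIV_okubo_idx)
  qed
qed

section \<open>Cube roots of unity and the conclusion\<close>

lemma no_primitive_cube_root_imp:
  fixes l :: "'f::field"
  assumes "CHAR('f) \<noteq> 3" and "\<not> (\<exists>w::'f. primitive_root_of_unity 3 w)"
  shows "l * l + l + 1 \<noteq> 0"
proof
  assume l: "l * l + l + 1 = 0"
  have "l ^ 3 - 1 = (l - 1) * (l * l + l + 1)"
    by (simp add: algebra_simps power3_eq_cube)
  then have l3: "l ^ 3 = 1"
    using l by simp
  \<comment> \<open>At \<open>l = 1\<close> the equation reads 3 = 0, so the characteristic divides
    3. It is never 1, hence it would be 3.\<close>
  have "l \<noteq> 1"
  proof
    assume "l = 1"
    with l have "of_nat 3 = (0::'f)"
      by simp
    then have "CHAR('f) dvd 3"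
      by (simp only: of_nat_eq_0_iff_char_dvd)
    moreover have "d = 1 \<or> d = 3" if "d dvd 3" for d :: nat
    proof -
      have "d \<le> 3"
        using that by (simp add: dvd_imp_le)
      then have "d = 0 \<or> d = 1 \<or> d = 2 \<or> d = 3"
        by arith
      then show ?thesis
        using that by auto
    qed
    ultimately have "CHAR('f) = 1 \<or> CHAR('f) = 3"
      by blast
    with assms(1) show False
      using CHAR_not_1 by auto
  qed
  \<comment> \<open>Otherwise \<open>l = l ^ 3 = 1\<close>.\<close>
  moreover have "l ^ 2 \<noteq> 1"
    using l3 \<open>l \<noteq> 1\<close> by (auto simp: power3_eq_cube power2_eq_square)
  ultimately have "l ^ k \<noteq> 1" if "0 < k" "k < 3" for k
    using that by (auto simp: less_Suc_eq numeral_3_eq_3 numeral_2_eq_2)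
  then have "primitive_root_of_unity 3 l"
    using l3 by (simp add: primitive_root_of_unity_def)
  with assms(2) show False
    by blast
qed

theorem lemma3p9:
  fixes s :: "'f::field \<Rightarrow> 'a::ab_group_add \<Rightarrow> 'a"
    and m :: "'a \<Rightarrow> 'a \<Rightarrow> 'a"
    and x :: 'a
  assumes "okubo_algebra_isotropic s m"
    and "CHAR('f) \<noteq> 3"
    and "\<not> (\<exists>w::'f. primitive_root_of_unity 3 w)"
    and "x \<in> zero_divisors m"
    and "m x x = 0"
  defines "C \<equiv> orthogonality_graph s m \<restriction> orthogonal_lines s m x"
  shows "C \<in> pre_digraph.sccs (orthogonality_graph s m)
    \<and> star_graph_with_internal_node C (line s x)
    \<and> diameter C = 2"
proof -
  obtain a b and \<phi> :: "'f ^ okubo_idx \<Rightarrow> 'a" where ab: "a \<noteq> 0" "b \<noteq> 0"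
    and \<phi>: "Vector_Spaces.linear (*s) s \<phi>" "bij \<phi>" "\<And>x y. \<phi> (okubo_mult a b x y) = m (\<phi> x) (\<phi> y)"
    using assms(1) unfolding okubo_algebra_isotropic_def by blast
  interpret okubo_composition s m "okubo_norm a b \<circ> inv \<phi>"
      "\<lambda>x y. okubo_polar a b (inv \<phi> x) (inv \<phi> y)"
    using okubo_composition_okubo_mult[OF ab] \<phi> by (rule okubo_composition_transfer)
  have "x \<noteq> 0"
    using assms(4) by (simp add: zero_divisors_def)
  then show ?thesis
    unfolding C_def
    using no_primitive_cube_root_imp[OF assms(2,3)] assms(5)
    by (intro star_component_orthogonality_graph)
qed

end
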